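(* Let $s\geq 1$, $k\geq 1$ be integers and $n\geq 2k+s+1$. Let $G$ be a connected simple graph of order $n$ with minimum degree $\delta(G)\geq k$. If $$\mu(\overline{G})\leq \sqrt{(k+s)(n-k-1)},$$ then $G$ is $s$-path-coverable unless $G\in EP_n$, or $s=1$ and $G=K_{k+1}+K_{n-k-1}$.
   Context: For a simple graph $H$, $\overline{H}$ denotes its complement and $\mu(H)$ denotes the spectral radius (largest eigenvalue) of the adjacency matrix of $H$. For disjoint graphs $G_1,G_2$, $G_1+G_2$ denotes their disjoint union, and the join $G_1\vee G_2$ is the graph on $V(G_1)\cup V(G_2)$ whose edges are those of $G_1$, those of $G_2$, and all edges $xy$ with $x\in V(G_1)$, $y\in V(G_2)$. $K_m$ is the complete graph on $m$ vertices. A graph $G$ is $s$-path-coverable if $V(G)$ can be covered by at most $s$ vertex-disjoint paths. $EP_n$ (depending on $n$ and $k$) is the set of graphs of order $n$ of the form $G_1\vee G_2$, where, for some integer $r$ with $0\le r\le k$, $G_1$ is an $r$-regular graph of order $n-k+r$ and $G_2$ is a spanning subgraph of $K_{k-r}$. *)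

theory Defs
  imports
    "Graph_Theory.Graph_Theory"
    "Jordan_Normal_Form.Spectral_Radius"
begin

text \<open>
  A finite simple graph is a \<^locale>\<open>pair_graph\<close>: an undirected edge \<open>uv\<close> is the pair of arcs
  \<open>(u,v)\<close>, \<open>(v,u)\<close>, so the degree of a vertex is its \<^const>\<open>out_degree\<close>.  The graph without
  vertices is a \<^locale>\<open>pair_graph\<close>.
\<close>

definition min_degree :: "'a pair_pre_digraph \<Rightarrow> nat" where
  "min_degree G = Min (out_degree (with_proj G) ` pverts G)"

definition regular_graph :: "nat \<Rightarrow> 'a pair_pre_digraph \<Rightarrow> bool" where
  "regular_graph r G \<longleftrightarrow> pair_graph G \<and> (\<forall>v \<in> pverts G. out_degree (with_proj G) v = r)"

definition graph_complement :: "'a pair_pre_digraph \<Rightarrow> 'a pair_pre_digraph" where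
  "graph_complement G =
     \<lparr> pverts = pverts G,
       parcs = {(u, v). u \<in> pverts G \<and> v \<in> pverts G \<and> u \<noteq> v \<and> (u, v) \<notin> parcs G} \<rparr>"

text \<open>The next two operations are meant for graphs with disjoint vertex sets.\<close>

definition graph_union :: "'a pair_pre_digraph \<Rightarrow> 'a pair_pre_digraph \<Rightarrow> 'a pair_pre_digraph" where
  "graph_union G1 G2 =
     \<lparr> pverts = pverts G1 \<union> pverts G2, parcs = parcs G1 \<union> parcs G2 \<rparr>"

definition graph_join :: "'a pair_pre_digraph \<Rightarrow> 'a pair_pre_digraph \<Rightarrow> 'a pair_pre_digraph" where
  "graph_join G1 G2 =
     \<lparr> pverts = pverts G1 \<union> pverts G2,
       parcs = parcs G1 \<union> parcs G2 \<union> pverts G1 \<times> pverts G2 \<union> pverts G2 \<times> pverts G1 \<rparr>"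

definition adjacency_matrix :: "'a list \<Rightarrow> 'a pair_pre_digraph \<Rightarrow> complex mat" where
  "adjacency_matrix vs G =
     mat (length vs) (length vs) (\<lambda>(i, j). if (vs ! i, vs ! j) \<in> parcs G then 1 else 0)"

text \<open>
  The enumeration of the vertices is arbitrary; by \<open>spectrum_adjacency_matrix\<close> below the
  spectrum does not depend on it.  As the matrix is nonnegative and symmetric, its spectral
  radius is its largest eigenvalue.
\<close>

definition graph_spectral_radius :: "'a pair_pre_digraph \<Rightarrow> real" where
  "graph_spectral_radius G =
     spectral_radius (adjacency_matrix (SOME vs. distinct vs \<and> set vs = pverts G) G)"

text \<open>A path is the list of its vertices; a single vertex is a path, the empty list is not.\<close>

definition path_coverable :: "nat \<Rightarrow> 'a pair_pre_digraph \<Rightarrow> bool" where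
  "path_coverable s G \<longleftrightarrow>
     (\<exists>P. finite P \<and> card P \<le> s \<and> (\<forall>p \<in> P. vpath p (with_proj G)) \<and>
          (\<forall>p \<in> P. \<forall>q \<in> P. p \<noteq> q \<longrightarrow> set p \<inter> set q = {}) \<and>
          (\<Union>p \<in> P. set p) = pverts G)"

definition EP :: "nat \<Rightarrow> nat \<Rightarrow> 'a pair_pre_digraph set" where
  "EP n k = {G. \<exists>r G1 G2 K. r \<le> k \<and> G = graph_join G1 G2 \<and> pverts G1 \<inter> pverts G2 = {} \<and>
     card (pverts G) = n \<and>
     regular_graph r G1 \<and> card (pverts G1) = n - k + r \<and>
     pair_graph G2 \<and> complete_digraph (k - r) (with_proj K) \<and>
     spanning (with_proj G2) (with_proj K)}"

definition is_union_of_complete :: "nat \<Rightarrow> nat \<Rightarrow> 'a pair_pre_digraph \<Rightarrow> bool" where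
  "is_union_of_complete a b G \<longleftrightarrow>
     (\<exists>A B. complete_digraph a (with_proj A) \<and> complete_digraph b (with_proj B) \<and>
            pverts A \<inter> pverts B = {} \<and> G = graph_union A B)"

lemma spectrum_adjacency_matrix:
  assumes "distinct vs" and "set vs = pverts G"
  shows "spectrum (adjacency_matrix vs G) =
    {c. \<exists>f. (\<exists>v \<in> pverts G. f v \<noteq> 0) \<and>
        (\<forall>u \<in> pverts G. (\<Sum>v \<in> pverts G. (if (u, v) \<in> parcs G then f v else 0)) = c * f u)}"
proof -
  let ?n = "length vs" and ?A = "adjacency_matrix vs G"
  have bij: "bij_betw ((!) vs) {0..<?n} (pverts G)"
    using assms by (metis atLeast0LessThan bij_betw_nth)
  have row: "row ?A i \<bullet> x = (\<Sum>v \<in> pverts G. (if (vs ! i, v) \<in> parcs G then f v else 0))"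
    if "i < ?n" "x \<in> carrier_vec ?n" "\<And>j. j < ?n \<Longrightarrow> x $ j = f (vs ! j)" for i x f
  proof -
    have "row ?A i \<bullet> x = (\<Sum>j\<in>{0..<?n}. (if (vs ! i, vs ! j) \<in> parcs G then f (vs ! j) else 0))"
      using that by (auto simp: scalar_prod_def adjacency_matrix_def intro!: sum.cong)
    also have "\<dots> = (\<Sum>v \<in> pverts G. (if (vs ! i, v) \<in> parcs G then f v else 0))"
      by (rule sum.reindex_bij_betw[OF bij])
    finally show ?thesis .
  qed
  have dim: "dim_row ?A = ?n" "dim_col ?A = ?n" by (simp_all add: adjacency_matrix_def)
  have key: "(x \<noteq> 0\<^sub>v ?n \<and> ?A *\<^sub>v x = c \<cdot>\<^sub>v x) \<longleftrightarrow> ((\<exists>v \<in> pverts G. f v \<noteq> 0) \<and>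
        (\<forall>u \<in> pverts G. (\<Sum>v \<in> pverts G. (if (u, v) \<in> parcs G then f v else 0)) = c * f u))"
    if x: "x \<in> carrier_vec ?n" and f: "\<And>j. j < ?n \<Longrightarrow> x $ j = f (vs ! j)" for x c f
  proof -
    have all: "(\<forall>v \<in> pverts G. P v) \<longleftrightarrow> (\<forall>j < ?n. P (vs ! j))" for P
      using assms(2) by (metis all_set_conv_all_nth)
    have "x = 0\<^sub>v ?n \<longleftrightarrow> (\<forall>j < ?n. f (vs ! j) = 0)"
      using x f by (auto simp: vec_eq_iff)
    moreover have "?A *\<^sub>v x = c \<cdot>\<^sub>v x \<longleftrightarrow> (\<forall>i < ?n. row ?A i \<bullet> x = c * f (vs ! i))"
      using x f dim by (auto simp: vec_eq_iff)
    ultimately show ?thesis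
      using all[of "\<lambda>v. f v = 0"]
        all[of "\<lambda>u. (\<Sum>v \<in> pverts G. (if (u, v) \<in> parcs G then f v else 0)) = c * f u"]
        row[OF _ x f] by auto
  qed
  show ?thesis (is "_ = ?R")
  proof (intro Set.set_eqI iffI)
    fix c assume "c \<in> spectrum ?A"
    then obtain x where x: "x \<in> carrier_vec ?n" "x \<noteq> 0\<^sub>v ?n \<and> ?A *\<^sub>v x = c \<cdot>\<^sub>v x"
      by (auto simp: spectrum_def eigenvalue_def eigenvector_def dim)
    define f where "f v = x $ (the_inv_into {0..<?n} ((!) vs) v)" for v
    have "x $ j = f (vs ! j)" if "j < ?n" for j
      using that bij by (simp add: f_def the_inv_into_f_f bij_betw_def)
    with key[OF x(1), of f c] x(2) show "c \<in> ?R" by blast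
  next
    fix c assume "c \<in> ?R"
    then obtain f where f: "(\<exists>v \<in> pverts G. f v \<noteq> 0) \<and>
        (\<forall>u \<in> pverts G. (\<Sum>v \<in> pverts G. (if (u, v) \<in> parcs G then f v else 0)) = c * f u)"
      by blast
    let ?x = "vec ?n (\<lambda>j. f (vs ! j))"
    have "?x \<noteq> 0\<^sub>v ?n \<and> ?A *\<^sub>v ?x = c \<cdot>\<^sub>v ?x"
      using key[of ?x f c] f by simp
    then show "c \<in> spectrum ?A"
      unfolding spectrum_def eigenvalue_def eigenvector_def by (auto simp: dim intro!: exI[of _ ?x])
  qed
qed

end

theory Submission
  imports Defs "HOL-Analysis.Convex"
begin

text \<open>
  Suppose that \<open>G\<close> is not \<open>s\<close>-path-coverable, i.e. every ordering of its vertices has at least \<open>s\<close>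
  consecutive non-adjacent pairs (gaps), and let \<open>H\<close> be an edge-maximal graph with this property
  on the same vertices containing \<open>G\<close>.  A Bondy--Chvatal exchange argument shows that non-adjacent
  vertices of \<open>H\<close> have degree sum at most \<open>n - s - 1\<close>.  Hence in the complement \<open>F\<close> of \<open>H\<close> every edge
  \<open>uv\<close> satisfies \<open>d u + d v \<ge> a + b\<close> with \<open>a = k + s\<close> and \<open>b = n - k - 1\<close>, while \<open>d \<le> b\<close> everywhere;
  so \<open>d u * d v \<ge> a * b\<close>.  The Rayleigh quotient of the complement of \<open>G\<close> at the vector \<open>sqrt (d v)\<close>
  is at least the average of \<open>sqrt (d u * d v)\<close> over the edges of \<open>F\<close>, so the spectral hypothesis
  forces \<open>{d u, d v} = {a, b}\<close> on every edge.  If \<open>a = b\<close>, then \<open>G\<close> is in \<open>EP n k\<close>.  If \<open>a < b\<close>, then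
  counting neighbours gives \<open>s = 1\<close> and \<open>F\<close> is complete bipartite, so \<open>H\<close> is disconnected, which
  contradicts the connectedness of \<open>G\<close>.

  Rayleigh quotients are bounded by the spectral radius because the powers of a matrix with spectral
  radius less than 1 are bounded, whereas for a symmetric matrix the norms of the iterates of a
  vector with Rayleigh quotient above 1 grow geometrically.
\<close>

section \<open>Orderings with few gaps\<close>

text \<open>An ordering with g gaps falls apart at them into g + 1 paths, so fewer than s gaps means
  a cover by at most s paths. The edge set is a bare relation because it varies over a fixed vertex
  set.\<close>

definition gaps :: "('a \<times> 'a) set \<Rightarrow> 'a list \<Rightarrow> nat" where
  "gaps E xs = length (filter (\<lambda>e. e \<notin> E) (vwalk_arcs xs))"

lemma gaps_simps [simp]:
  "gaps E [] = 0" "gaps E [x] = 0"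
  "gaps E (x # y # xs) = (if (x, y) \<in> E then 0 else 1) + gaps E (y # xs)"
  by (simp_all add: gaps_def)

lemma gaps_append:
  assumes "xs \<noteq> []" "ys \<noteq> []"
  shows "gaps E (xs @ ys) = gaps E xs + (if (last xs, hd ys) \<in> E then 0 else 1) + gaps E ys"
  using assms
proof (induction xs rule: vwalk_arcs.induct)
  case (2 x)
  then show ?case by (cases ys) auto
qed auto

lemma gaps_rev:
  assumes "sym E"
  shows "gaps E (rev xs) = gaps E xs"
proof (induction xs rule: vwalk_arcs.induct)
  case (3 x y xs)
  have "gaps E (rev (x # y # xs)) = gaps E (rev (y # xs) @ [x])" by simp
  also have "\<dots> = gaps E (rev (y # xs)) + (if (y, x) \<in> E then 0 else 1)"
    by (subst gaps_append) auto
  also have "\<dots> = gaps E (x # y # xs)"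
    using 3 assms by (auto dest: symD)
  finally show ?case .
qed auto

lemma gaps_cong:
  assumes "\<And>x y. x \<in> set xs \<Longrightarrow> y \<in> set xs \<Longrightarrow> (x, y) \<in> E \<longleftrightarrow> (x, y) \<in> E'"
  shows "gaps E xs = gaps E' xs"
  using assms by (induction xs rule: vwalk_arcs.induct) auto

text \<open>Position i is the cut between \<open>take i xs\<close> and \<open>drop i xs\<close>;
  indexing gaps this way lets them be counted alongside neighbours of the two ends.\<close>

lemma gaps_conv_card:
  "gaps E xs = card {i \<in> {1..<length xs}. (xs ! (i - 1), xs ! i) \<notin> E}"
proof (induction xs rule: vwalk_arcs.induct)
  case (3 x y xs)
  let ?S = "\<lambda>zs. {i \<in> {1..<length zs}. (zs ! (i - 1), zs ! i) \<notin> E}"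
  have "?S (x # y # xs) = (if (x, y) \<in> E then {} else {1}) \<union> Suc ` ?S (y # xs)" (is "?L = ?R")
  proof (intro Set.set_eqI)
    fix i
    show "i \<in> ?L \<longleftrightarrow> i \<in> ?R"
    proof (cases i)
      case (Suc j)
      then show ?thesis by (cases j) (auto simp: image_iff)
    qed auto
  qed
  moreover have "card (Suc ` ?S (y # xs)) = card (?S (y # xs))"
    by (simp add: card_image)
  moreover have "1 \<notin> Suc ` ?S (y # xs)" by auto
  ultimately have "card (?S (x # y # xs)) = (if (x, y) \<in> E then 0 else 1) + card (?S (y # xs))"
    by auto
  then show ?case using 3 by simp
qed auto

text \<open>With \<open>E'\<close> = \<open>UNIV\<close> this locates a gap; with \<open>E'\<close>
  = \<open>E\<close> plus one edge it locates a place where the ordering uses the new edge.\<close>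

lemma gaps_less_imp_split:
  assumes "gaps E' xs < gaps E xs"
  shows "\<exists>ps qs. xs = ps @ qs \<and> ps \<noteq> [] \<and> qs \<noteq> [] \<and>
    (last ps, hd qs) \<in> E' \<and> (last ps, hd qs) \<notin> E"
  using assms
proof (induction xs rule: vwalk_arcs.induct)
  case (3 x y xs)
  show ?case
  proof (cases "(x, y) \<in> E' \<and> (x, y) \<notin> E")
    case True
    then show ?thesis by (intro exI[of _ "[x]"] exI[of _ "y # xs"]) auto
  next
    case False
    then have "gaps E' (y # xs) < gaps E (y # xs)" using 3(2) by (auto split: if_splits)
    from 3(1)[OF this] obtain ps qs where "y # xs = ps @ qs" "ps \<noteq> []" "qs \<noteq> []"
      "(last ps, hd qs) \<in> E' \<and> (last ps, hd qs) \<notin> E" by blast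
    then show ?thesis by (intro exI[of _ "x # ps"] exI[of _ qs]) auto
  qed
qed auto

lemma gaps_UNIV [simp]: "gaps UNIV xs = 0"
  by (simp add: gaps_def)

text \<open>Adjacent ends close the ordering into a cycle. Cutting the cycle at a gap instead gains
  the closing edge and loses that gap.\<close>

lemma rotate_fewer_gaps:
  assumes "gaps E xs > 0" "(last xs, hd xs) \<in> E"
  shows "\<exists>ys. set ys = set xs \<and> (distinct xs \<longrightarrow> distinct ys) \<and> gaps E ys < gaps E xs"
proof -
  obtain ps qs where *: "xs = ps @ qs" "ps \<noteq> []" "qs \<noteq> []" "(last ps, hd qs) \<notin> E"
    using gaps_less_imp_split[of UNIV xs E] assms(1) by auto
  then show ?thesis
    using assms(2) by (intro exI[of _ "qs @ ps"]) (auto simp: gaps_append)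
qed

lemma split_into_walks:
  assumes "xs \<noteq> []"
  shows "\<exists>ps. concat ps = xs \<and> [] \<notin> set ps \<and> length ps = Suc (gaps E xs) \<and>
    (\<forall>p \<in> set ps. set (vwalk_arcs p) \<subseteq> E)"
  using assms
proof (induction xs rule: vwalk_arcs.induct)
  case (2 x)
  show ?case by (intro exI[of _ "[[x]]"]) auto
next
  case (3 x y xs)
  then obtain ps where ps: "concat ps = y # xs" "[] \<notin> set ps" "length ps = Suc (gaps E (y # xs))"
    "\<forall>p \<in> set ps. set (vwalk_arcs p) \<subseteq> E" by auto
  then obtain p ps' where p: "ps = p # ps'" "p \<noteq> []" by (cases ps) auto
  then obtain p' where p': "p = y # p'" using ps(1) by (cases p) auto
  show ?case
  proof (cases "(x, y) \<in> E")
    case True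
    then show ?thesis using ps p p' by (intro exI[of _ "(x # p) # ps'"]) auto
  next
    case False
    then show ?thesis using ps by (intro exI[of _ "[x] # ps"]) auto
  qed
qed auto

lemma path_coverable_if_gaps_less:
  assumes "distinct xs" "set xs = pverts G" "xs \<noteq> []" "gaps (parcs G) xs < s"
  shows "path_coverable s G"
proof -
  obtain ps where ps: "concat ps = xs" "[] \<notin> set ps" "length ps = Suc (gaps (parcs G) xs)"
    "\<forall>p \<in> set ps. set (vwalk_arcs p) \<subseteq> parcs G"
    using split_into_walks[OF assms(3)] by blast
  have dist: "distinct (concat ps)" using ps assms by simp
  show ?thesis
    unfolding path_coverable_def
  proof (intro exI[of _ "set ps"] conjI ballI impI)
    show "card (set ps) \<le> s"
      using card_length[of ps] ps(3) assms(4) by linarith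
    show "vpath p (with_proj G)" if "p \<in> set ps" for p
      using that ps dist assms(2) by (auto simp: vpath_def vwalk_def distinct_concat_iff)
    show "set p \<inter> set q = {}" if "p \<in> set ps" "q \<in> set ps" "p \<noteq> q" for p q
      using that dist by (auto simp: distinct_concat_iff)
    show "(\<Union>p \<in> set ps. set p) = pverts G"
      unfolding set_concat[symmetric] ps(1) by (rule assms(2))
  qed auto
qed

section \<open>Exchange argument: degree sums from extremal orderings\<close>

text \<open>
  Reversing \<open>xs\<close> replaces the pair at the split by \<open>(hd xs, hd ys)\<close>, and reversing \<open>ys\<close> replaces it
  by \<open>(last xs, last ys)\<close>; if the ends of the new ordering are adjacent, it can moreover be rotated
  to start at a gap.
\<close>

lemma crossing_splits:
  assumes "sym E" and s: "s \<ge> 1"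
    and W: "distinct (xs @ ys)" "xs \<noteq> []" "ys \<noteq> []" "gaps E (xs @ ys) \<le> s"
    and min: "\<And>zs. distinct zs \<Longrightarrow> set zs = set (xs @ ys) \<Longrightarrow> s \<le> gaps E zs"
  shows "\<not> ((hd xs, hd ys) \<in> E \<and> (last ys, last xs) \<in> E)"
    and "(last xs, hd ys) \<notin> E \<Longrightarrow> (hd xs, hd ys) \<notin> E"
    and "(last xs, hd ys) \<notin> E \<Longrightarrow> (last ys, last xs) \<notin> E"
proof -
  let ?R = "rev xs @ ys"
  have R: "distinct ?R" "set ?R = set (xs @ ys)" using W by auto
  have gR: "gaps E ?R = gaps E xs + (if (hd xs, hd ys) \<in> E then 0 else 1) + gaps E ys"
    using W gaps_append[of "rev xs" ys E] by (simp add: gaps_rev[OF \<open>sym E\<close>] last_rev)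
  have gW: "gaps E (xs @ ys) = gaps E xs + (if (last xs, hd ys) \<in> E then 0 else 1) + gaps E ys"
    using W gaps_append by blast
  show "(hd xs, hd ys) \<notin> E" if "(last xs, hd ys) \<notin> E"
    using min[OF R] gR gW W(4) that by (auto split: if_splits)
  show "(last ys, last xs) \<notin> E" if "(last xs, hd ys) \<notin> E"
  proof
    assume "(last ys, last xs) \<in> E"
    then have "(last xs, last ys) \<in> E" using \<open>sym E\<close> by (meson symD)
    then have "gaps E (xs @ rev ys) = gaps E xs + gaps E ys"
      using W gaps_append[of xs "rev ys" E] by (simp add: gaps_rev[OF \<open>sym E\<close>] hd_rev)
    moreover have "s \<le> gaps E (xs @ rev ys)" using W by (intro min) auto
    ultimately show False using gW W(4) that by simp
  qed
  show "\<not> ((hd xs, hd ys) \<in> E \<and> (last ys, last xs) \<in> E)"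
  proof
    assume A: "(hd xs, hd ys) \<in> E \<and> (last ys, last xs) \<in> E"
    then have "gaps E ?R \<le> s" using gR gW W(4) by simp
    moreover have "gaps E ?R > 0" using min[OF R] s by simp
    moreover have "(last ?R, hd ?R) \<in> E" using A W by (simp add: hd_rev)
    ultimately obtain zs where zs: "set zs = set ?R" "distinct ?R \<longrightarrow> distinct zs"
      "gaps E zs < gaps E ?R"
      using rotate_fewer_gaps[of E ?R] by blast
    then have "s \<le> gaps E zs" using R by (intro min) (blast, simp)
    then show False using zs(3) \<open>gaps E ?R \<le> s\<close> by linarith
  qed
qed

text \<open>By \<open>crossing_splits\<close>, each of the \<open>length W - 1\<close> cut positions
  has at most one of three properties: its left vertex is a neighbour of \<open>last W\<close>, its
  right vertex is a neighbour of \<open>hd W\<close>, or it is a gap. The last set has at least s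
  elements.\<close>

lemma degree_sum_of_extremal_ordering:
  assumes "sym E" "irrefl E" "E \<subseteq> set W \<times> set W" and s: "s \<ge> 1"
    and W: "distinct W" "W \<noteq> []" "gaps E W \<le> s"
    and min: "\<And>zs. distinct zs \<Longrightarrow> set zs = set W \<Longrightarrow> s \<le> gaps E zs"
  shows "card (E `` {hd W}) + card (E `` {last W}) + s + 1 \<le> length W"
proof -
  let ?n = "length W" and ?u = "last W" and ?v = "hd W"
  let ?S = "{i \<in> {1..<?n}. (?u, W ! (i - 1)) \<in> E}" and ?T = "{i \<in> {1..<?n}. (?v, W ! i) \<in> E}"
    and ?D = "{i \<in> {1..<?n}. (W ! (i - 1), W ! i) \<notin> E}"
  have split: "\<not> ((?v, W ! i) \<in> E \<and> (?u, W ! (i - 1)) \<in> E)"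
    "(W ! (i - 1), W ! i) \<notin> E \<Longrightarrow> (?v, W ! i) \<notin> E"
    "(W ! (i - 1), W ! i) \<notin> E \<Longrightarrow> (?u, W ! (i - 1)) \<notin> E"
    if i: "i \<in> {1..<?n}" for i
  proof -
    have ne: "take i W \<noteq> []" "drop i W \<noteq> []" using i by auto
    have eq: "hd (take i W) = ?v" "last (drop i W) = ?u" "hd (drop i W) = W ! i"
      "last (take i W) = W ! (i - 1)"
      using i ne by (auto simp: hd_drop_conv_nth last_conv_nth)
    note c = crossing_splits[OF \<open>sym E\<close> s, of "take i W" "drop i W"]
    show "\<not> ((?v, W ! i) \<in> E \<and> (?u, W ! (i - 1)) \<in> E)"
      using c(1) ne W min by (simp add: eq del: take_eq_Nil drop_eq_Nil)
    show "(W ! (i - 1), W ! i) \<notin> E \<Longrightarrow> (?v, W ! i) \<notin> E"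
      using c(2) ne W min by (simp add: eq del: take_eq_Nil drop_eq_Nil)
    show "(W ! (i - 1), W ! i) \<notin> E \<Longrightarrow> (?u, W ! (i - 1)) \<notin> E"
      using c(3) ne W min by (simp add: eq del: take_eq_Nil drop_eq_Nil)
  qed
  have n: "?n > 0" using W by simp
  have S: "card (E `` {?u}) = card ?S"
  proof -
    \<comment> \<open>A neighbour at index j is recorded at position j + 1. This is in range because
      the last index holds \<open>?u\<close> itself, and there are no loops; index 0 is excluded
      likewise for \<open>?v\<close> below.\<close>
    have "E `` {?u} = (\<lambda>i. W ! (i - 1)) ` ?S"
    proof (intro equalityI subsetI)
      fix x assume x: "x \<in> E `` {?u}"
      then have "x \<in> set W" "x \<noteq> ?u" using assms(2,3) by (auto simp: irrefl_def)
      then obtain j where j: "j < ?n" "W ! j = x" by (auto simp: in_set_conv_nth)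
      then have "j \<noteq> ?n - 1" using \<open>x \<noteq> ?u\<close> W by (auto simp: last_conv_nth)
      then show "x \<in> (\<lambda>i. W ! (i - 1)) ` ?S"
        using j x by (intro image_eqI[of _ _ "Suc j"]) auto
    qed auto
    moreover have "inj_on (\<lambda>i. W ! (i - 1)) ?S"
      using W by (intro inj_onI) (auto simp: nth_eq_iff_index_eq)
    ultimately show ?thesis by (simp add: card_image)
  qed
  have T: "card (E `` {?v}) = card ?T"
  proof -
    have "E `` {?v} = (!) W ` ?T"
    proof (intro equalityI subsetI)
      fix x assume x: "x \<in> E `` {?v}"
      then have "x \<in> set W" "x \<noteq> ?v" using assms(2,3) by (auto simp: irrefl_def)
      then obtain j where j: "j < ?n" "W ! j = x" by (auto simp: in_set_conv_nth)
      then have "j \<noteq> 0" using \<open>x \<noteq> ?v\<close> W(2) by (metis hd_conv_nth)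
      then show "x \<in> (!) W ` ?T"
        using j x by (intro image_eqI[of _ _ j]) auto
    qed auto
    moreover have "inj_on ((!) W) ?T"
      using W by (intro inj_onI) (auto simp: nth_eq_iff_index_eq)
    ultimately show ?thesis by (simp add: card_image)
  qed
  have "card ?S + card ?T + card ?D = card (?S \<union> ?T \<union> ?D)"
  proof -
    have "?S \<inter> ?T = {}" "(?S \<union> ?T) \<inter> ?D = {}" using split by blast+
    then show ?thesis by (simp add: card_Un_disjoint)
  qed
  also have "\<dots> \<le> card {1..<?n}" by (intro card_mono) auto
  finally have "card ?S + card ?T + gaps E W \<le> ?n - 1"
    by (simp add: gaps_conv_card)
  moreover have "s \<le> gaps E W" using min W by blast
  ultimately show ?thesis using S T n by linarith
qed

text \<open>An ordering with fewer than s gaps must use the added edge uv. Swapping the two pieces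
  on either side of it moves u and v to the ends and creates at most one gap, so the new ordering
  has at most s gaps in \<open>E\<close> and is extremal.\<close>

lemma degree_sum_of_maximal_nontraceable:
  assumes "sym E" "irrefl E" "E \<subseteq> V \<times> V" and s: "s \<ge> 1"
    and min: "\<And>zs. distinct zs \<Longrightarrow> set zs = V \<Longrightarrow> s \<le> gaps E zs"
    and W: "distinct W" "set W = V" "gaps (insert (u, v) (insert (v, u) E)) W < s"
  shows "card (E `` {u}) + card (E `` {v}) + s + 1 \<le> card V"
proof -
  let ?E = "insert (u, v) (insert (v, u) E)"
  obtain ps qs where split: "W = ps @ qs" "ps \<noteq> []" "qs \<noteq> []" "(last ps, hd qs) \<in> ?E"
    "(last ps, hd qs) \<notin> E"
    using gaps_less_imp_split[of ?E W E] W min[of W] by force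
  have ends: "{last ps, hd qs} = {u, v}" using split by auto
  \<comment> \<open>Neither piece contains both ends of the new edge, so dropping that edge leaves
    the gap counts of the pieces unchanged.\<close>
  have "last ps \<notin> set qs" "hd qs \<notin> set ps" using W split(1-3)
    by (auto dest: last_in_set hd_in_set)
  then have "gaps ?E ps = gaps E ps" "gaps ?E qs = gaps E qs"
    using ends by (auto intro!: gaps_cong simp: doubleton_eq_iff)
  then have "gaps E (qs @ ps) \<le> s"
    using W(3) split by (simp add: gaps_append split: if_splits)
  then have "card (E `` {hd (qs @ ps)}) + card (E `` {last (qs @ ps)}) + s + 1 \<le> length (qs @ ps)"
    using assms(1-3) s W split min
    by (intro degree_sum_of_extremal_ordering) (auto simp: Un_commute)
  moreover have "length (qs @ ps) = card V"
    using W split distinct_card[of W] by simp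
  ultimately show ?thesis using ends split by (auto simp: doubleton_eq_iff)
qed

section \<open>Rayleigh quotients\<close>

text \<open>Real functions keep iterates and inner products real, whereas
  \<open>spectral_radius\<close> refers to complex matrices; \<open>cmat\<close> is the
  bridge.\<close>

definition mat_apply :: "nat \<Rightarrow> (nat \<Rightarrow> nat \<Rightarrow> real) \<Rightarrow> (nat \<Rightarrow> real) \<Rightarrow> nat \<Rightarrow> real" where
  "mat_apply n a x i = (\<Sum>j<n. a i j * x j)"

abbreviation cmat :: "nat \<Rightarrow> (nat \<Rightarrow> nat \<Rightarrow> real) \<Rightarrow> complex mat" where
  "cmat n a \<equiv> mat n n (\<lambda>(i, j). complex_of_real (a i j))"

lemma cmat_pow_mult_vec:
  "cmat n a ^\<^sub>m m *\<^sub>v vec n (\<lambda>i. complex_of_real (x i)) =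
   vec n (\<lambda>i. complex_of_real ((mat_apply n a ^^ m) x i))"
proof (induction m arbitrary: x)
  case (Suc m)
  have A: "cmat n a \<in> carrier_mat n n" by simp
  have "cmat n a *\<^sub>v vec n (\<lambda>i. complex_of_real (x i)) =
      vec n (\<lambda>i. complex_of_real (mat_apply n a x i))"
    by (intro eq_vecI) (auto simp: scalar_prod_def mat_apply_def atLeast0LessThan)
  moreover have "cmat n a ^\<^sub>m Suc m *\<^sub>v vec n (\<lambda>i. complex_of_real (x i)) =
      cmat n a ^\<^sub>m m *\<^sub>v (cmat n a *\<^sub>v vec n (\<lambda>i. complex_of_real (x i)))"
    using A by (simp add: assoc_mult_mat_vec[of _ n n _ n])
  ultimately show ?case
    using Suc[of "mat_apply n a x"] by (simp add: funpow_swap1)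
qed (auto intro!: eq_vecI)

text \<open>The Jordan normal form gives one bound c for the entries of all powers; each coordinate
  of an iterate is then at most c times the sum of the absolute values of x.\<close>

lemma mat_apply_pow_bounded:
  assumes "spectral_radius (cmat n a) < 1"
  shows "\<exists>M. \<forall>m. \<forall>i<n. \<bar>(mat_apply n a ^^ m) x i\<bar> \<le> M"
proof -
  let ?A = "cmat n a"
  obtain c where c: "norm_bound (?A ^\<^sub>m m) c" for m
    using spectral_radius_jnf_norm_bound_less_1_upper_triangular[OF _ assms, of n] by auto
  have "\<bar>(mat_apply n a ^^ m) x i\<bar> \<le> (\<Sum>j<n. c * \<bar>x j\<bar>)" if i: "i < n" for m i
  proof -
    have Am: "?A ^\<^sub>m m \<in> carrier_mat n n" by simp
    have "complex_of_real ((mat_apply n a ^^ m) x i) =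
        (?A ^\<^sub>m m *\<^sub>v vec n (\<lambda>i. complex_of_real (x i))) $ i"
      using i by (simp add: cmat_pow_mult_vec)
    also have "\<dots> = (\<Sum>j<n. (?A ^\<^sub>m m) $$ (i, j) * complex_of_real (x j))"
      using i Am by (auto simp: scalar_prod_def atLeast0LessThan intro!: sum.cong)
    finally have "\<bar>(mat_apply n a ^^ m) x i\<bar> =
        norm (\<Sum>j<n. (?A ^\<^sub>m m) $$ (i, j) * complex_of_real (x j))"
      by (metis norm_of_real real_norm_def)
    also have "\<dots> \<le> (\<Sum>j<n. c * \<bar>x j\<bar>)"
    proof (intro sum_norm_le)
      fix j assume "j \<in> {..<n}"
      then have "norm ((?A ^\<^sub>m m) $$ (i, j)) \<le> c"
        using c[of m] i Am unfolding norm_bound_def by auto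
      then show "norm ((?A ^\<^sub>m m) $$ (i, j) * complex_of_real (x j)) \<le> c * \<bar>x j\<bar>"
        by (simp add: norm_mult mult_right_mono)
    qed
    finally show ?thesis .
  qed
  then show ?thesis by blast
qed

definition dot :: "nat \<Rightarrow> (nat \<Rightarrow> real) \<Rightarrow> (nat \<Rightarrow> real) \<Rightarrow> real" where
  "dot n x y = (\<Sum>i<n. x i * y i)"

lemma dot_mat_apply:
  assumes "\<And>i j. i < n \<Longrightarrow> j < n \<Longrightarrow> a i j = a j i"
  shows "dot n x (mat_apply n a y) = dot n (mat_apply n a x) y"
proof -
  have "dot n x (mat_apply n a y) = (\<Sum>i<n. \<Sum>j<n. x i * (a i j * y j))"
    by (simp add: dot_def mat_apply_def sum_distrib_left)
  also have "\<dots> = (\<Sum>j<n. \<Sum>i<n. x i * (a i j * y j))"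
    by (rule sum.swap)
  also have "\<dots> = dot n (mat_apply n a x) y"
    unfolding dot_def mat_apply_def sum_distrib_right using assms
    by (intro sum.cong refl) (simp add: mult_ac)
  finally show ?thesis .
qed

lemma dot_Cauchy_Schwarz: "(dot n x y)\<^sup>2 \<le> dot n x x * dot n y y"
  using Cauchy_Schwarz_ineq_sum[of x y "{..<n}"] by (simp add: dot_def power2_eq_square)

lemma dot_self_nonneg: "0 \<le> dot n x x"
  by (simp add: dot_def sum_nonneg)

lemma rayleigh_le_if_spectral_radius_less_1:
  assumes sym: "\<And>i j. i < n \<Longrightarrow> j < n \<Longrightarrow> a i j = a j i"
    and rad: "spectral_radius (cmat n a) < 1"
  shows "dot n x (mat_apply n a x) \<le> dot n x x"
proof (rule ccontr)
  let ?T = "mat_apply n a"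
  let ?f = "\<lambda>m. (?T ^^ m) x"
  let ?N = "\<lambda>m. dot n (?f m) (?f m)"
  assume "\<not> ?thesis"
  then have q: "dot n x x < dot n x (?T x)" by simp
  have nz: "?N 0 > 0"
  proof (rule ccontr)
    assume "\<not> ?N 0 > 0"
    then have "dot n x x = 0" using dot_self_nonneg[of n x] by simp
    then show False using q dot_Cauchy_Schwarz[of n x "?T x"] by simp
  qed
  define r where "r = ?N 1 / ?N 0"
  \<comment> \<open>Cauchy-Schwarz for x and \<open>?T x\<close> turns a Rayleigh quotient above 1
    into growth of the norm at the first iteration.\<close>
  have "(?N 0)\<^sup>2 < (dot n x (?T x))\<^sup>2"
    using q nz by (intro power_strict_mono) auto
  also have "\<dots> \<le> ?N 0 * ?N 1" using dot_Cauchy_Schwarz[of n x "?T x"] by simp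
  finally have "?N 0 < ?N 1" using nz by (simp add: power2_eq_square)
  then have r: "r > 1" using nz by (simp add: r_def)
  \<comment> \<open>Symmetry makes the squared norms of the iterates log-convex, so their ratios increase.\<close>
  have step: "(?N (Suc m))\<^sup>2 \<le> ?N m * ?N (Suc (Suc m))" for m
    using dot_Cauchy_Schwarz[of n "?f m" "?T (?T (?f m))"]
    by (simp add: dot_mat_apply[OF sym])
  have grow: "?N m > 0 \<and> ?N (Suc m) \<ge> r * ?N m" for m
  proof (induction m)
    case 0
    then show ?case using nz by (simp add: r_def)
  next
    case (Suc m)
    have "0 < r * ?N m" using Suc r by simp
    then have pos: "?N (Suc m) > 0" using Suc by linarith
    have "r * ?N m * ?N (Suc m) \<le> (?N (Suc m))\<^sup>2"
      using Suc pos by (simp add: power2_eq_square mult_right_mono)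
    also have "\<dots> \<le> ?N m * ?N (Suc (Suc m))" by (rule step)
    finally have "?N m * (r * ?N (Suc m)) \<le> ?N m * ?N (Suc (Suc m))" by (simp add: mult_ac)
    then show ?case using Suc pos by simp
  qed
  have low: "r ^ m * ?N 0 \<le> ?N m" for m
  proof (induction m)
    case (Suc m)
    have "r ^ Suc m * ?N 0 \<le> r * ?N m" using Suc r by (simp add: mult.assoc)
    also have "\<dots> \<le> ?N (Suc m)" using grow by blast
    finally show ?case .
  qed auto
  obtain M where M: "\<And>m i. i < n \<Longrightarrow> \<bar>?f m i\<bar> \<le> M"
    using mat_apply_pow_bounded[OF rad] by blast
  have up: "?N m \<le> real n * M\<^sup>2" for m
  proof -
    have "?N m \<le> (\<Sum>i<n. M\<^sup>2)"
      unfolding dot_def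
    proof (intro sum_mono)
      fix i assume "i \<in> {..<n}"
      then have "\<bar>?f m i\<bar>\<^sup>2 \<le> M\<^sup>2" using M by (intro power_mono) auto
      then show "?f m i * ?f m i \<le> M\<^sup>2" by (simp add: power2_eq_square)
    qed
    then show ?thesis by simp
  qed
  obtain m where "real n * M\<^sup>2 / ?N 0 < r ^ m" using r real_arch_pow by blast
  then have "real n * M\<^sup>2 < r ^ m * ?N 0" using nz by (simp add: field_simps)
  then show False using low[of m] up[of m] by linarith
qed

text \<open>Dividing the matrix by any c above its spectral radius reduces to the previous bound;
  then c tends to the spectral radius, which may itself be 0 and so cannot serve as the
  divisor.\<close>

lemma rayleigh_le_spectral_radius:
  assumes sym: "\<And>i j. i < n \<Longrightarrow> j < n \<Longrightarrow> a i j = a j i"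
  shows "dot n x (mat_apply n a x) \<le> spectral_radius (cmat n a) * dot n x x"
proof (cases "n = 0")
  case True
  then show ?thesis by (simp add: dot_def)
next
  case False
  let ?A = "cmat n a" and ?\<rho> = "spectral_radius (cmat n a)"
  have A: "?A \<in> carrier_mat n n" by simp
  have \<rho>0: "?\<rho> \<ge> 0" using spectral_radius_mem_max(1)[OF A] False by auto
  have le: "dot n x (mat_apply n a x) \<le> c * dot n x x" if c: "c > ?\<rho>" for c
  proof -
    let ?b = "\<lambda>i j. a i j / c"
    have c0: "c > 0" using c \<rho>0 by simp
    have B: "cmat n ?b \<in> carrier_mat n n" by simp
    obtain e where e: "e \<in> spectrum (cmat n ?b)" "spectral_radius (cmat n ?b) = norm e"
      using spectral_radius_mem_max(1)[OF B] False by auto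
    then obtain v where v: "v \<in> carrier_vec n" "v \<noteq> 0\<^sub>v n" "cmat n ?b *\<^sub>v v = e \<cdot>\<^sub>v v"
      by (auto simp: spectrum_def eigenvalue_def eigenvector_def)
    \<comment> \<open>An eigenvalue e of the scaled matrix yields the eigenvalue c * e of the
      original, so the scaled spectral radius is below 1.\<close>
    have "?A *\<^sub>v v = complex_of_real c \<cdot>\<^sub>v (cmat n ?b *\<^sub>v v)"
      using c0 v(1) by (intro eq_vecI) (auto simp: scalar_prod_def sum_distrib_left intro!: sum.cong)
    then have "complex_of_real c * e \<in> spectrum ?A"
      using v by (auto simp: spectrum_def eigenvalue_def eigenvector_def smult_smult_assoc)
    then have "norm (complex_of_real c * e) \<le> ?\<rho>"
      using spectral_radius_mem_max(2)[OF A] False by blast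
    then have "c * norm e \<le> ?\<rho>" using c0 by (simp add: norm_mult)
    then have "c * norm e < c * 1" using c by linarith
    then have "spectral_radius (cmat n ?b) < 1"
      using e(2) c0 by (simp only: mult_less_cancel_left_pos)
    then have "dot n x (mat_apply n ?b x) \<le> dot n x x"
      using sym by (intro rayleigh_le_if_spectral_radius_less_1) auto
    moreover have "dot n x (mat_apply n ?b x) = dot n x (mat_apply n a x) / c"
      by (simp add: dot_def mat_apply_def sum_divide_distrib sum_distrib_left)
    ultimately show ?thesis using c0 by (simp add: field_simps)
  qed
  show ?thesis
  proof (cases "dot n x x = 0")
    case True
    then show ?thesis using le[of "?\<rho> + 1"] by simp
  next
    case False
    then have "dot n x x > 0" using dot_self_nonneg[of n x] by simp
    then have "dot n x (mat_apply n a x) / dot n x x \<le> c" if "c > ?\<rho>" for c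
      using le[OF that] by (simp add: field_simps)
    then have "dot n x (mat_apply n a x) / dot n x x \<le> ?\<rho>" by (rule dense_ge)
    then show ?thesis using \<open>dot n x x > 0\<close> by (simp add: field_simps)
  qed
qed

text \<open>Both orientations of an edge are arcs, so the left side is the quadratic form of the
  adjacency matrix, with no factor 2.\<close>

lemma graph_rayleigh_le_spectral_radius:
  assumes fin: "finite (pverts K)" and sub: "parcs K \<subseteq> pverts K \<times> pverts K" and "sym (parcs K)"
  shows "(\<Sum>(u, v) \<in> parcs K. x u * x v) \<le> graph_spectral_radius K * (\<Sum>v \<in> pverts K. (x v)\<^sup>2)"
proof -
  \<comment> \<open>This is the enumeration chosen inside \<open>graph_spectral_radius\<close>, so
    the two matrices coincide.\<close>
  define vs where "vs = (SOME vs. distinct vs \<and> set vs = pverts K)"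
  have vs: "distinct vs" "set vs = pverts K"
    using someI_ex[of "\<lambda>vs. distinct vs \<and> set vs = pverts K"] finite_distinct_list[OF fin]
    unfolding vs_def by blast+
  let ?n = "length vs"
  define a :: "nat \<Rightarrow> nat \<Rightarrow> real" where "a i j = (if (vs ! i, vs ! j) \<in> parcs K then 1 else 0)" for i j
  let ?y = "\<lambda>i. x (vs ! i)"
  have bij: "bij_betw ((!) vs) {..<?n} (pverts K)"
    using vs by (metis bij_betw_nth)
  have "adjacency_matrix vs K = cmat ?n a"
    by (auto simp: adjacency_matrix_def a_def intro!: eq_matI)
  then have \<rho>: "graph_spectral_radius K = spectral_radius (cmat ?n a)"
    by (simp add: graph_spectral_radius_def vs_def)
  have "(\<Sum>(u, v) \<in> parcs K. x u * x v) =
      (\<Sum>(u, v) \<in> pverts K \<times> pverts K. if (u, v) \<in> parcs K then x u * x v else 0)"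
    using fin sub by (intro sum.mono_neutral_cong_left) auto
  also have "\<dots> = (\<Sum>u \<in> pverts K. \<Sum>v \<in> pverts K. if (u, v) \<in> parcs K then x u * x v else 0)"
    by (simp add: sum.cartesian_product)
  also have "\<dots> = (\<Sum>i<?n. \<Sum>j<?n. if (vs ! i, vs ! j) \<in> parcs K then ?y i * ?y j else 0)"
    by (simp add: sum.reindex_bij_betw[OF bij, symmetric])
  also have "\<dots> = dot ?n ?y (mat_apply ?n a ?y)"
    by (auto simp: dot_def mat_apply_def a_def sum_distrib_left intro!: sum.cong)
  also have "\<dots> \<le> spectral_radius (cmat ?n a) * dot ?n ?y ?y"
    using \<open>sym (parcs K)\<close> by (intro rayleigh_le_spectral_radius) (auto simp: a_def dest: symD)
  also have "dot ?n ?y ?y = (\<Sum>v \<in> pverts K. (x v)\<^sup>2)"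
    by (simp add: dot_def power2_eq_square sum.reindex_bij_betw[OF bij, symmetric])
  finally show ?thesis by (simp add: \<rho>)
qed

section \<open>The extremal degrees of the complement\<close>

lemma pair_graphI:
  assumes "finite (pverts G)" "parcs G \<subseteq> pverts G \<times> pverts G" "irrefl (parcs G)" "sym (parcs G)"
  shows "pair_graph G"
proof
  show "finite (parcs G)" using assms by (meson finite_SigmaI finite_subset)
  show "symmetric (with_proj G)" using assms by (simp add: symmetric_def)
qed (use assms in \<open>auto simp: irrefl_def\<close>)

lemma pair_graphD:
  assumes "pair_graph G"
  shows "finite (pverts G)" "parcs G \<subseteq> pverts G \<times> pverts G" "irrefl (parcs G)" "sym (parcs G)"
proof -
  interpret pair_graph G by fact
  show "finite (pverts G)" by (rule pair_finite_verts)
  show "parcs G \<subseteq> pverts G \<times> pverts G" by (auto dest: in_arcsD1 in_arcsD2)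
  show "irrefl (parcs G)" using pair_no_loops by (fastforce simp: irrefl_def)
  show "sym (parcs G)" using pair_sym_arcs by (simp add: symmetric_def)
qed

lemma out_degree_with_proj: "out_degree (with_proj G) v = card (parcs G `` {v})"
proof -
  have "out_arcs (with_proj G) v = Pair v ` (parcs G `` {v})"
    by (auto simp: out_arcs_def)
  then show ?thesis by (simp add: out_degree_def card_image inj_on_def)
qed

text \<open>Symmetry makes the arcs equal to their symmetric closure, so connectedness gives a walk
  from A to B; without a crossing arc it could never leave A.\<close>

lemma connected_no_cut:
  assumes "connected (with_proj G)" "pverts G = A \<union> B" "A \<noteq> {}" "B \<noteq> {}" "A \<inter> B = {}"
    "sym (parcs G)"
  shows "\<exists>u \<in> A. \<exists>v \<in> B. (u, v) \<in> parcs G"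
proof (rule ccontr)
  assume no: "\<not> ?thesis"
  obtain u v where uv: "u \<in> A" "v \<in> B" using assms by auto
  have "(parcs G)\<^sup>s = parcs G"
    using assms(6) by (auto simp: symcl_def dest: symD)
  then have "(u, v) \<in> rtrancl_on (pverts G) (parcs G)"
    using assms(1,2) uv by (auto simp: connected_conv)
  then have "v \<in> A"
    using no uv assms(2) by (induction rule: rtrancl_on_induct) auto
  then show False using uv assms(5) by auto
qed

text \<open>The arcs of \<open>graph_complement\<close>, for a relation, so that it applies to the
  edge-maximal supergraph too.\<close>

definition co_arcs :: "'a set \<Rightarrow> ('a \<times> 'a) set \<Rightarrow> ('a \<times> 'a) set" where
  "co_arcs V E = {(u, v). u \<in> V \<and> v \<in> V \<and> u \<noteq> v \<and> (u, v) \<notin> E}"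

lemma card_co_arcs:
  assumes "finite V" "E \<subseteq> V \<times> V" "irrefl E" "v \<in> V"
  shows "card (E `` {v}) + card (co_arcs V E `` {v}) + 1 = card V"
proof -
  have "V = insert v (E `` {v} \<union> co_arcs V E `` {v})"
    using assms by (auto simp: co_arcs_def)
  moreover have "v \<notin> E `` {v} \<union> co_arcs V E `` {v}" "E `` {v} \<inter> co_arcs V E `` {v} = {}"
    using assms by (auto simp: co_arcs_def irrefl_def)
  moreover have "finite (E `` {v})" "finite (co_arcs V E `` {v})"
    using assms by (auto simp: co_arcs_def intro: finite_subset[OF _ \<open>finite V\<close>])
  ultimately show ?thesis
    by (metis Suc_eq_plus1 card_Un_disjoint card_insert_disjoint finite_UnI)
qed

text \<open>For \<open>K\<close> the complement of G and \<open>F\<close> that of its maximal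
  supergraph. The terms of the quadratic form over \<open>F\<close> are each at least c, yet the
  spectral bound makes their sum at most c times \<open>card F\<close>; hence every term equals
  c.\<close>

lemma product_of_degrees_if_radius_le:
  assumes K: "finite (pverts K)" "parcs K \<subseteq> pverts K \<times> pverts K" "sym (parcs K)"
    and F: "F \<subseteq> parcs K" and c: "c \<ge> 0" "graph_spectral_radius K \<le> c"
    and edge: "\<And>u v. (u, v) \<in> F \<Longrightarrow> c\<^sup>2 \<le> real (card (F `` {u})) * real (card (F `` {v}))"
    and uv: "(u, v) \<in> F"
  shows "real (card (F `` {u})) * real (card (F `` {v})) = c\<^sup>2"
proof -
  let ?V = "pverts K"
  define d where "d v = real (card (F `` {v}))" for v
  define x where "x v = sqrt (d v)" for v
  have d0: "d v \<ge> 0" for v by (simp add: d_def)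
  have finK: "finite (parcs K)" using K by (meson finite_SigmaI finite_subset)
  then have finF: "finite F" using F finite_subset by blast
  have ge: "c \<le> x u * x v" if "(u, v) \<in> F" for u v
    using edge[OF that] c(1) by (simp add: x_def d_def real_sqrt_mult[symmetric] real_le_rsqrt)
  have "finite (F `` {v})" for v
    using F K by (intro finite_subset[OF _ K(1)]) auto
  \<comment> \<open>Counting arcs by their first vertex: the squared test vector sums to
    \<open>card F\<close>.\<close>
  then have "card (SIGMA v:?V. F `` {v}) = (\<Sum>v \<in> ?V. card (F `` {v}))"
    using K(1) by simp
  moreover have "(SIGMA v:?V. F `` {v}) = F" using F K by auto
  ultimately have sum_d: "(\<Sum>v \<in> ?V. (x v)\<^sup>2) = real (card F)"
    by (simp add: x_def d_def)
  have "(\<Sum>(u, v) \<in> F. x u * x v) \<le> (\<Sum>(u, v) \<in> parcs K. x u * x v)"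
    using finK F d0 by (intro sum_mono2) (auto simp: x_def)
  also have "\<dots> \<le> graph_spectral_radius K * (\<Sum>v \<in> ?V. (x v)\<^sup>2)"
    using K by (rule graph_rayleigh_le_spectral_radius)
  also have "\<dots> \<le> c * real (card F)"
    unfolding sum_d using c by (intro mult_right_mono) auto
  finally have "(\<Sum>(u, v) \<in> F. x u * x v - c) \<le> 0"
    by (simp add: case_prod_unfold sum_subtractf mult.commute)
  moreover have nn: "\<And>e. e \<in> F \<Longrightarrow> 0 \<le> (case e of (u, v) \<Rightarrow> x u * x v - c)"
    using ge by auto
  ultimately have "(\<Sum>(u, v) \<in> F. x u * x v - c) = 0"
    by (meson antisym sum_nonneg)
  then have "\<forall>e \<in> F. (case e of (u, v) \<Rightarrow> x u * x v - c) = 0"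
    using sum_nonneg_eq_0_iff[OF finF nn] by simp
  then have "x u * x v = c" using uv by auto
  then have "c\<^sup>2 = (x u)\<^sup>2 * (x v)\<^sup>2" using power_mult_distrib by blast
  then show ?thesis using d0 by (simp add: x_def d_def)
qed

text \<open>Both parts come from (b - x)(b - y) >= 0, which expands to x y >= b (x + y - b) >= a b.
  Equality makes one factor vanish. The differences p and q avoid subtraction on naturals.\<close>

lemma
  fixes a b x y :: nat
  assumes "x \<le> b" "y \<le> b" "a + b \<le> x + y"
  shows mult_le_of_add_le: "a * b \<le> x * y"
    and mult_eq_imp_extremal: "x * y = a * b \<Longrightarrow> b > 0 \<Longrightarrow> x = a \<and> y = b \<or> x = b \<and> y = a"
proof -
  obtain p q where p: "b = x + p" "b = y + q" using assms(1,2) le_Suc_ex by blast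
  have "b * b = (x + p) * (y + q)" "b * x = (y + q) * x" "b * y = (x + p) * y"
    using p by simp_all
  then have "p * q + b * (x + y) = b * b + x * y" by (simp add: algebra_simps)
  moreover have "b * b + a * b \<le> b * (x + y)"
    using mult_le_mono2[OF assms(3), of b] by (simp add: algebra_simps)
  ultimately have *: "p * q + a * b \<le> x * y" by linarith
  then show "a * b \<le> x * y" by simp
  assume "x * y = a * b" "b > 0"
  then have "p = 0 \<or> q = 0" using * by simp
  then have "x = b \<or> y = b" using p by auto
  then show "x = a \<and> y = b \<or> x = b \<and> y = a"
    using \<open>x * y = a * b\<close> \<open>b > 0\<close> by auto
qed

text \<open>There are only finitely many edge sets on V. At a maximal one, adding any missing edge
  must produce an ordering with fewer than s gaps, which is what the degree-sum bound needs.\<close>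

lemma ex_maximal_without_ordering:
  assumes "finite V" "E \<subseteq> V \<times> V" "irrefl E" "sym E"
    and no: "\<And>zs. distinct zs \<Longrightarrow> set zs = V \<Longrightarrow> s \<le> gaps E zs"
  shows "\<exists>H. E \<subseteq> H \<and> H \<subseteq> V \<times> V \<and> irrefl H \<and> sym H \<and>
    (\<forall>zs. distinct zs \<longrightarrow> set zs = V \<longrightarrow> s \<le> gaps H zs) \<and>
    (\<forall>(u, v) \<in> co_arcs V H. \<exists>zs. distinct zs \<and> set zs = V \<and>
       gaps (insert (u, v) (insert (v, u) H)) zs < s)"
proof -
  define \<H> where "\<H> = {H. E \<subseteq> H \<and> H \<subseteq> V \<times> V \<and> irrefl H \<and> sym H \<and>
    (\<forall>zs. distinct zs \<longrightarrow> set zs = V \<longrightarrow> s \<le> gaps H zs)}"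
  have "\<H> \<subseteq> Pow (V \<times> V)" by (auto simp: \<H>_def)
  then have "finite \<H>" using assms(1) by (meson finite_Pow_iff finite_SigmaI finite_subset)
  moreover have "E \<in> \<H>" using assms by (auto simp: \<H>_def)
  ultimately obtain H where H: "H \<in> \<H>" and max: "\<And>H'. H' \<in> \<H> \<Longrightarrow> H \<subseteq> H' \<Longrightarrow> H' = H"
    using finite_has_maximal[of \<H>] by blast
  have "\<exists>zs. distinct zs \<and> set zs = V \<and> gaps (insert (u, v) (insert (v, u) H)) zs < s"
    if uv: "(u, v) \<in> co_arcs V H" for u v
  proof (rule ccontr)
    let ?H = "insert (u, v) (insert (v, u) H)"
    assume "\<not> ?thesis"
    then have "?H \<in> \<H>"
      using H uv unfolding \<H>_def by (auto simp: co_arcs_def irrefl_def sym_def not_less)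
    then show False using max[of ?H] uv by (auto simp: co_arcs_def)
  qed
  then show ?thesis using H unfolding \<H>_def by blast
qed

lemma gaps_complete:
  assumes "distinct zs" "co_arcs (set zs) E = {}"
  shows "gaps E zs = 0"
  using assms
proof (induction zs rule: vwalk_arcs.induct)
  case (3 x y xs)
  then show ?case by (auto simp: co_arcs_def)
qed auto

theorem theorem3p4:
  fixes G :: "'a pair_pre_digraph" and s k n :: nat
  assumes "s \<ge> 1" and "k \<ge> 1" and "n \<ge> 2 * k + s + 1"
    and "pair_graph G" and "connected (with_proj G)" and "card (pverts G) = n"
    and "min_degree G \<ge> k"
    and "graph_spectral_radius (graph_complement G)
           \<le> sqrt ((real k + real s) * (real n - real k - 1))"
  shows "path_coverable s G \<or> G \<in> EP n k \<or>
         (s = 1 \<and> is_union_of_complete (k + 1) (n - k - 1) G)"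
proof (cases "path_coverable s G")
  case False
  let ?V = "pverts G" and ?E = "parcs G" and ?K = "graph_complement G"
  note G = pair_graphD[OF assms(4)]
  have V: "?V \<noteq> {}" using assms(3,6) by auto
  have "s \<le> gaps ?E zs" if "distinct zs" "set zs = ?V" for zs
    using path_coverable_if_gaps_less[OF that] False V that by (metis not_le set_empty)
  from ex_maximal_without_ordering[OF G this] obtain H where
    H: "?E \<subseteq> H" "H \<subseteq> ?V \<times> ?V" "irrefl H" "sym H"
    and Hno: "\<And>zs. distinct zs \<Longrightarrow> set zs = ?V \<Longrightarrow> s \<le> gaps H zs"
    and Hmax: "\<forall>(u, v) \<in> co_arcs ?V H. \<exists>zs. distinct zs \<and> set zs = ?V \<and>
       gaps (insert (u, v) (insert (v, u) H)) zs < s"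
    by blast
  define F where "F = co_arcs ?V H"
  define d where "d v = card (F `` {v})" for v
  \<comment> \<open>The product a b is the squared spectral bound, and b is the largest degree that
    the minimum degree k allows in the complement. The hypothesis on n gives a <= b.\<close>
  define a where "a = k + s"
  define b where "b = n - k - 1"
  have ab: "a \<le> b" "a + b + 1 = n + s" "b > 0" "b + k + 1 = n"
    using assms(1-3) by (auto simp: a_def b_def)
  have arcsK: "pverts ?K = ?V" "parcs ?K = co_arcs ?V ?E"
    by (auto simp: graph_complement_def co_arcs_def)
  have FK: "F \<subseteq> co_arcs ?V ?E" using H by (auto simp: F_def co_arcs_def)
  have symF: "(v, u) \<in> F" if "(u, v) \<in> F" for u v
    using that H(4) by (auto simp: F_def co_arcs_def dest: symD)
  have FV: "F \<subseteq> ?V \<times> ?V" by (auto simp: F_def co_arcs_def)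
  \<comment> \<open>If \<open>H\<close> were complete, any ordering would have no gaps, against s >=
    1.\<close>
  have Fne: "F \<noteq> {}"
  proof
    assume "F = {}"
    obtain zs where "distinct zs" "set zs = ?V" using finite_distinct_list[OF G(1)] by blast
    then show False using gaps_complete[of zs H] \<open>F = {}\<close> Hno[of zs] assms(1) by (simp add: F_def)
  qed
  have degG: "k \<le> card (?E `` {v})" if "v \<in> ?V" for v
  proof -
    have "min_degree G \<le> out_degree (with_proj G) v"
      unfolding min_degree_def using that G(1) by (intro Min_le) auto
    then show ?thesis using assms(7) by (simp add: out_degree_with_proj)
  qed
  have dK: "card (co_arcs ?V ?E `` {v}) \<le> b" if "v \<in> ?V" for v
    using card_co_arcs[OF G(1-3) that] degG[OF that] assms(6) ab by linarith
  have fin: "finite (co_arcs ?V ?E `` {v})" for v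
    using G(1) by (rule finite_subset[rotated]) (auto simp: co_arcs_def)
  have d_le: "d v \<le> b" if "v \<in> ?V" for v
    using card_mono[OF fin Image_mono[OF FK order_refl]] dK[OF that]
    unfolding d_def by (rule order_trans)
  \<comment> \<open>Complementing the degree-sum bound for \<open>H\<close>: 2 (n - 1) - (n - s - 1)
    = n + s - 1 = a + b.\<close>
  have d_sum: "a + b \<le> d u + d v" if uv: "(u, v) \<in> F" for u v
  proof -
    obtain zs where "distinct zs" "set zs = ?V" "gaps (insert (u, v) (insert (v, u) H)) zs < s"
      using Hmax uv by (auto simp: F_def)
    then have "card (H `` {u}) + card (H `` {v}) + s + 1 \<le> n"
      using degree_sum_of_maximal_nontraceable[OF H(4,3,2) assms(1) Hno] assms(6) by blast
    moreover have "u \<in> ?V" "v \<in> ?V" using uv FV by auto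
    ultimately show ?thesis
      using card_co_arcs[OF G(1) H(2,3), of u] card_co_arcs[OF G(1) H(2,3), of v] assms(6) ab
      by (simp add: d_def F_def)
  qed
  let ?c = "sqrt (real (a * b))"
  have d_prod: "d u * d v = a * b" if uv: "(u, v) \<in> F" for u v
  proof -
    have "real (card (F `` {u})) * real (card (F `` {v})) = ?c\<^sup>2"
    proof (rule product_of_degrees_if_radius_le[where K = ?K])
      show "graph_spectral_radius ?K \<le> ?c"
      proof -
        have "real k + real s = real a" "real n - real k - 1 = real b"
          using ab(4) by (auto simp: a_def)
        then show ?thesis using assms(8) by simp
      qed
      show "sym (parcs ?K)" using G(4) by (auto simp: arcsK co_arcs_def sym_def)
      show "?c\<^sup>2 \<le> real (card (F `` {u})) * real (card (F `` {v}))" if uv: "(u, v) \<in> F" for u v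
      proof -
        have le: "d u \<le> b" "d v \<le> b" using d_le uv FV by auto
        have "a * b \<le> d u * d v" using le d_sum[OF uv] by (rule mult_le_of_add_le)
        then have "real (a * b) \<le> real (d u * d v)" by (simp only: of_nat_le_iff)
        then show ?thesis by (simp add: d_def)
      qed
    qed (use G FK uv in \<open>auto simp: arcsK co_arcs_def\<close>)
    then have "real (d u * d v) = real (a * b)" by (simp add: d_def)
    then show ?thesis by (simp only: of_nat_eq_iff)
  qed
  have d_cases: "d u = a \<and> d v = b \<or> d u = b \<and> d v = a" if uv: "(u, v) \<in> F" for u v
    using mult_eq_imp_extremal[OF _ _ d_sum[OF uv] d_prod[OF uv] ab(3)] d_le uv FV by auto
  show ?thesis
  proof (cases "a = b")
    case True
    \<comment> \<open>Every vertex that is not isolated in \<open>F\<close> has degree b there. The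
      isolated vertices \<open>I\<close> will form \<open>G2\<close>, the others
      \<open>G1\<close>.\<close>
    define I where "I = {v \<in> ?V. F `` {v} = {}}"
    define R where "R = ?V - I"
    have R: "card (F `` {v}) = b" if "v \<in> R" for v
    proof -
      obtain w where "(v, w) \<in> F" using \<open>v \<in> R\<close> by (auto simp: R_def I_def)
      then show ?thesis using d_cases True by (auto simp: d_def)
    qed
    \<comment> \<open>These vertices already have the largest degree that the minimum degree of \<open>G\<close> allows in its
      complement, so passing from \<open>H\<close> to \<open>G\<close> removes no edge at them.\<close>
    have satur: "co_arcs ?V ?E `` {v} = F `` {v}" if "v \<in> R" for v
    proof -
      have "v \<in> ?V" using that by (simp add: R_def)
      have "F `` {v} \<subseteq> co_arcs ?V ?E `` {v}" using FK by auto
      then show ?thesis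
        using dK[OF \<open>v \<in> ?V\<close>] R[OF that] card_seteq[OF fin] by metis
    qed
    have join: "(v, w) \<in> ?E \<and> (w, v) \<in> ?E" if "v \<in> R" "w \<in> I" for v w
    proof -
      have "(v, w) \<notin> F" using that symF by (auto simp: I_def)
      then have "w \<notin> co_arcs ?V ?E `` {v}" using satur[OF that(1)] by auto
      then have "(v, w) \<in> ?E" using that by (auto simp: co_arcs_def R_def I_def)
      then show ?thesis using G(4) by (auto dest: symD)
    qed
    have VRI: "R \<union> I = ?V" "R \<inter> I = {}" by (auto simp: R_def I_def)
    have finRI: "finite R" "finite I" using G(1) by (simp_all add: R_def I_def)
    have degR: "card (?E `` {v}) = k" if "v \<in> R" for v
    proof -
      have "v \<in> ?V" using that by (simp add: R_def)
      from card_co_arcs[OF G(1-3) this] show ?thesis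
        using R[OF that] satur[OF that] assms(6) ab(4) by simp
    qed
    obtain v0 where v0: "v0 \<in> R" using Fne FV by (auto simp: R_def I_def)
    have split_nbrs: "card (?E `` {v}) = card ((?E \<inter> R \<times> R) `` {v}) + card I" if "v \<in> R" for v
    proof -
      have "?E `` {v} = (?E \<inter> R \<times> R) `` {v} \<union> I"
      proof (intro equalityI subsetI)
        fix w assume w: "w \<in> ?E `` {v}"
        then have "w \<in> R \<union> I" using G(2) unfolding VRI(1) by auto
        then show "w \<in> (?E \<inter> R \<times> R) `` {v} \<union> I" using w that by auto
      qed (use join that in auto)
      moreover have "(?E \<inter> R \<times> R) `` {v} \<inter> I = {}" using VRI by auto
      moreover have "finite ((?E \<inter> R \<times> R) `` {v})" by (rule finite_subset[OF _ finRI(1)]) auto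
      ultimately show ?thesis using finRI by (simp add: card_Un_disjoint)
    qed
    \<comment> \<open>A vertex of \<open>R\<close> has degree k in G and is joined to all of
      \<open>I\<close>. This bound makes the truncated difference \<open>k - card I\<close>
      exact.\<close>
    have cI: "card I \<le> k" using split_nbrs[OF v0] degR[OF v0] by simp
    have cR: "card R + card I = n"
      using card_Un_disjoint[OF finRI VRI(2)] assms(6) VRI(1) by simp
    let ?G1 = "\<lparr>pverts = R, parcs = ?E \<inter> R \<times> R\<rparr>" and ?G2 = "\<lparr>pverts = I, parcs = ?E \<inter> I \<times> I\<rparr>"
      and ?KI = "\<lparr>pverts = I, parcs = {(u, v). (u, v) \<in> I \<times> I \<and> u \<noteq> v}\<rparr>"
    have pg: "pair_graph ?G1" "pair_graph ?G2" "pair_graph ?KI"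
      using G finRI by (auto intro!: pair_graphI simp: irrefl_def sym_def)
    have "G \<in> EP n k"
      unfolding EP_def mem_Collect_eq
    proof (intro exI conjI)
      \<comment> \<open>The witness is r = \<open>k - card I\<close>, the degree left inside
        \<open>R\<close> once the neighbours in \<open>I\<close> are removed; \<open>card I\<close>
        is then k - r.\<close>
      show "k - card I \<le> k" by simp
      show "G = graph_join ?G1 ?G2"
      proof (intro pair_pre_digraph.equality)
        have "?E \<subseteq> (R \<union> I) \<times> (R \<union> I)" using G(2) unfolding VRI(1) .
        then show "?E = parcs (graph_join ?G1 ?G2)" using join by (auto simp: graph_join_def)
      qed (simp_all add: graph_join_def VRI)
      show "pverts ?G1 \<inter> pverts ?G2 = {}" using VRI by simp
      show "card ?V = n" by fact
      show "regular_graph (k - card I) ?G1"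
        using pg split_nbrs degR by (auto simp: regular_graph_def out_degree_with_proj)
      show "card (pverts ?G1) = n - k + (k - card I)" using cR cI assms(3) by simp
      show "pair_graph ?G2" by (rule pg)
      show "complete_digraph (k - (k - card I)) (with_proj ?KI)"
        using cI finRI by (simp add: complete_digraph_pair_def)
      have "wf_digraph (with_proj ?KI)" "wf_digraph (with_proj ?G2)"
        by unfold_locales auto
      then show "spanning (with_proj ?G2) (with_proj ?KI)"
        using G(3) by (auto simp: spanning_def subgraph_def compatible_def irrefl_def)
    qed
    then show ?thesis by blast
  next
    case False
    \<comment> \<open>Since a < b here, every edge of \<open>F\<close> joins \<open>A\<close> to
      \<open>B\<close>, so neighbourhoods give \<open>card B\<close> >= a and \<open>card A\<close>
      >= b. As a + b = n + s - 1 >= n, all these bounds are tight and \<open>A\<close>,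
      \<open>B\<close> exhaust the vertices.\<close>
    define A where "A = {v \<in> ?V. d v = a}"
    define B where "B = {v \<in> ?V. d v = b}"
    have finAB: "finite A" "finite B" "A \<inter> B = {}" "A \<union> B \<subseteq> ?V"
      using G(1) False by (auto simp: A_def B_def)
    have nB: "F `` {v} \<subseteq> A" if "v \<in> B" for v
      using that d_cases FV False by (fastforce simp: A_def B_def)
    have nA: "F `` {v} \<subseteq> B" if "v \<in> A" for v
      using that d_cases FV False by (fastforce simp: A_def B_def)
    obtain u v where "(u, v) \<in> F" using Fne by auto
    then obtain x y where xy: "x \<in> A" "y \<in> B"
      using d_cases[of u v] FV by (auto simp: A_def B_def)
    have "a \<le> card B" using card_mono[OF finAB(2) nA[OF xy(1)]] xy by (simp add: A_def d_def)
    have "b \<le> card A" using card_mono[OF finAB(1) nB[OF xy(2)]] xy by (simp add: B_def d_def)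
    have "card A + card B = card (A \<union> B)" using finAB by (simp add: card_Un_disjoint)
    also have "\<dots> \<le> n" using card_mono[OF G(1) finAB(4)] assms(6) by simp
    finally have "card A + card B \<le> n" .
    then have "card A + card B = n" "card A = b"
      using \<open>a \<le> card B\<close> \<open>b \<le> card A\<close> ab assms(1) by linarith+
    then have V_eq: "?V = A \<union> B"
      using card_seteq[OF G(1) finAB(4)] finAB assms(6) by (simp add: card_Un_disjoint)
    \<comment> \<open>Connectedness supplies an edge of G across the two classes, but tightness
      makes all of \<open>A\<close> the \<open>F\<close>-neighbourhood of q, so pq is a non-edge of
      G.\<close>
    obtain p q where pq: "p \<in> A" "q \<in> B" "(p, q) \<in> ?E"
      using connected_no_cut[OF assms(5) V_eq _ _ finAB(3) G(4)] xy by auto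
    have "F `` {q} = A"
      using card_seteq[OF finAB(1) nB[OF pq(2)]] pq(2) \<open>card A = b\<close> by (simp add: B_def d_def)
    then have "(q, p) \<in> F" using pq by auto
    then have "(p, q) \<in> F" by (rule symF)
    then show ?thesis using pq FK by (auto simp: co_arcs_def)
  qed
qed simp

end
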